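(* Let $(w_{\alpha t})_{t\ge 0}$, $(\mathbf{z}^*_{nt})_{t\ge 1}$ ($n=1,\dots,N$) and $(\mathbf{s}_t)_{t\ge 1}$ be sequences generated by the herding dynamics, so that for all $t\ge 1$ and all $\alpha$ $$w_{\alpha t} = w_{\alpha,t-1} + \bar g_{\alpha t} - g_\alpha(s_{\alpha t}),\qquad \bar g_{\alpha t} = \frac1N\sum_{n=1}^N g_\alpha(x_{\alpha n}, z^*_{\alpha n t}).$$ If $\lim_{\tau\to\infty}\frac1\tau w_{\alpha\tau}=0$ for all $\alpha$, then for all $\alpha$ the time averages $\frac1T\sum_{t=1}^T g_\alpha(s_{\alpha t})$ and $\frac1T\sum_{t=1}^T \bar g_{\alpha t}$ agree in the limit $T\to\infty$, i.e. $$\lim_{T\to\infty}\left(\frac1T\sum_{t=1}^T g_\alpha(s_{\alpha t}) - \frac1T\sum_{t=1}^T \bar g_{\alpha t}\right)=0.$$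
   Context: There are finitely many discrete variables, split into visible ones $\mathbf{x}$ and hidden ones $\mathbf{z}$, each taking finitely many values; a joint state is $\mathbf{s}=(\mathbf{x},\mathbf{z})$. There are finitely many features, indexed by $\alpha$; the feature $g_\alpha$ is a real-valued function of a subset $s_\alpha=(x_\alpha,z_\alpha)$ of the variables. A dataset $\mathbf{x}_1,\dots,\mathbf{x}_N$ ($N\ge1$) of visible configurations is fixed; $x_{\alpha n}$ is the restriction of $\mathbf{x}_n$ to the variables of feature $\alpha$, and likewise $z^*_{\alpha n t}$, $s_{\alpha t}$ are the restrictions of $\mathbf{z}^*_{nt}$, $\mathbf{s}_t$. Herding dynamics: starting from real weights $w_{\alpha 0}$, at each time $t\ge1$ one chooses hidden states $\mathbf{z}^*_{nt}$ for each $n$, by (exact or only approximate) maximization of $\sum_\alpha w_{\alpha,t-1}g_\alpha(x_{\alpha n},z_{\alpha n})$ over $\mathbf{z}_n$, and a joint state $\mathbf{s}_t$, by (exact or only approximate) maximization of $\sum_\alpha w_{\alpha,t-1}g_\alpha(s_\alpha)$ over $\mathbf{s}$; the weights are then updated as in the displayed recursion. No assumption on the quality of the maximizations is made, so the chosen states may be arbitrary. *)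

theory Defs
  imports Complex_Main "HOL-Library.FuncSet"
begin

(* A configuration assigns a value to each variable of a finite index set.
   Variables may have different finite ranges: DV i is the set of values of the
   visible variable i, DH j that of the hidden variable j.  Configurations are the
   extensional functions in Pi\<^sub>E V DV and Pi\<^sub>E H DH, and a joint state is a pair
   (visible configuration, hidden configuration). *)

type_synonym ('v, 'a, 'h, 'b) joint_state = "('v \<Rightarrow> 'a) \<times> ('h \<Rightarrow> 'b)"

(* s\<^sub>\<alpha>, for a feature \<alpha> that depends on the visible variables XS \<alpha> and the hidden
   variables ZS \<alpha>.  Features are only ever applied to such restrictions, which is
   how "g \<alpha> is a function of these variables" is expressed. *)
definition restrict_state ::
  "('f \<Rightarrow> 'v set) \<Rightarrow> ('f \<Rightarrow> 'h set) \<Rightarrow> 'f \<Rightarrow> ('v, 'a, 'h, 'b) joint_state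
     \<Rightarrow> ('v, 'a, 'h, 'b) joint_state" where
  "restrict_state XS ZS \<alpha> s = (restrict (fst s) (XS \<alpha>), restrict (snd s) (ZS \<alpha>))"

definition feature_value ::
  "('f \<Rightarrow> 'v set) \<Rightarrow> ('f \<Rightarrow> 'h set) \<Rightarrow> ('f \<Rightarrow> ('v, 'a, 'h, 'b) joint_state \<Rightarrow> real)
     \<Rightarrow> 'f \<Rightarrow> ('v, 'a, 'h, 'b) joint_state \<Rightarrow> real" where
  "feature_value XS ZS g \<alpha> s = g \<alpha> (restrict_state XS ZS \<alpha> s)"

definition data_average ::
  "('f \<Rightarrow> 'v set) \<Rightarrow> ('f \<Rightarrow> 'h set) \<Rightarrow> ('f \<Rightarrow> ('v, 'a, 'h, 'b) joint_state \<Rightarrow> real)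
     \<Rightarrow> nat \<Rightarrow> (nat \<Rightarrow> 'v \<Rightarrow> 'a) \<Rightarrow> (nat \<Rightarrow> nat \<Rightarrow> 'h \<Rightarrow> 'b) \<Rightarrow> 'f \<Rightarrow> nat \<Rightarrow> real" where
  "data_average XS ZS g N x zstar \<alpha> t =
     (1 / real N) * (\<Sum>n=1..N. feature_value XS ZS g \<alpha> (x n, zstar n t))"

(* The states zstar n t and s t come from maximizations that may be arbitrarily
   inexact, so they are only required to be configurations of the model.  The
   initial weights w \<alpha> 0 are arbitrary. *)
definition herding_dynamics ::
  "'v set \<Rightarrow> ('v \<Rightarrow> 'a set) \<Rightarrow> 'h set \<Rightarrow> ('h \<Rightarrow> 'b set) \<Rightarrow> 'f set
     \<Rightarrow> ('f \<Rightarrow> 'v set) \<Rightarrow> ('f \<Rightarrow> 'h set) \<Rightarrow> ('f \<Rightarrow> ('v, 'a, 'h, 'b) joint_state \<Rightarrow> real)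
     \<Rightarrow> nat \<Rightarrow> (nat \<Rightarrow> 'v \<Rightarrow> 'a)
     \<Rightarrow> ('f \<Rightarrow> nat \<Rightarrow> real) \<Rightarrow> (nat \<Rightarrow> nat \<Rightarrow> 'h \<Rightarrow> 'b) \<Rightarrow> (nat \<Rightarrow> ('v, 'a, 'h, 'b) joint_state)
     \<Rightarrow> bool" where
  "herding_dynamics V DV H DH F XS ZS g N x w zstar s \<longleftrightarrow>
     (\<forall>t\<ge>1. (\<forall>n\<in>{1..N}. zstar n t \<in> Pi\<^sub>E H DH) \<and>
            s t \<in> Pi\<^sub>E V DV \<times> Pi\<^sub>E H DH \<and>
            (\<forall>\<alpha>\<in>F. w \<alpha> t = w \<alpha> (t - 1) + data_average XS ZS g N x zstar \<alpha> t
                              - feature_value XS ZS g \<alpha> (s t)))"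

end

theory Submission
  imports Defs
begin

text \<open>Summed over t = 1, ..., T, the weight recursion telescopes: the accumulated gap between
  the sampled features and the data averages is exactly \<open>w \<alpha> 0 - w \<alpha> T\<close>.
  After division by T, the fixed initial weight contributes a term of order 1/T, and the final
  weight contributes a term that vanishes by the assumed sublinear growth.\<close>

theorem proposition1:
  fixes V :: "'v set" and DV :: "'v \<Rightarrow> 'a set"
    and H :: "'h set" and DH :: "'h \<Rightarrow> 'b set"
    and F :: "'f set" and XS :: "'f \<Rightarrow> 'v set" and ZS :: "'f \<Rightarrow> 'h set"
    and g :: "'f \<Rightarrow> ('v, 'a, 'h, 'b) joint_state \<Rightarrow> real"
    and N :: nat and x :: "nat \<Rightarrow> 'v \<Rightarrow> 'a"
    and w :: "'f \<Rightarrow> nat \<Rightarrow> real"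
    and zstar :: "nat \<Rightarrow> nat \<Rightarrow> 'h \<Rightarrow> 'b"
    and s :: "nat \<Rightarrow> ('v, 'a, 'h, 'b) joint_state"
  assumes "finite V" and "\<And>i. i \<in> V \<Longrightarrow> finite (DV i)"
    and "finite H" and "\<And>j. j \<in> H \<Longrightarrow> finite (DH j)"
    and "finite F"
    and "\<And>\<alpha>. \<alpha> \<in> F \<Longrightarrow> XS \<alpha> \<subseteq> V" and "\<And>\<alpha>. \<alpha> \<in> F \<Longrightarrow> ZS \<alpha> \<subseteq> H"
    and "N \<ge> 1" and "\<And>n. n \<in> {1..N} \<Longrightarrow> x n \<in> Pi\<^sub>E V DV"
    and "herding_dynamics V DV H DH F XS ZS g N x w zstar s"
    and "\<And>\<alpha>. \<alpha> \<in> F \<Longrightarrow> (\<lambda>\<tau>. (1 / real \<tau>) * w \<alpha> \<tau>) \<longlonglongrightarrow> 0"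
  shows "\<forall>\<alpha>\<in>F. (\<lambda>T. (1 / real T) * (\<Sum>t=1..T. feature_value XS ZS g \<alpha> (s t))
                   - (1 / real T) * (\<Sum>t=1..T. data_average XS ZS g N x zstar \<alpha> t))
                \<longlonglongrightarrow> 0"
proof
  fix \<alpha> assume \<alpha>: "\<alpha> \<in> F"
  define f where "f = (\<lambda>t. feature_value XS ZS g \<alpha> (s t))"
  define d where "d = data_average XS ZS g N x zstar \<alpha>"
  \<comment> \<open>The recursion is shifted to \<open>Suc t\<close>, which removes the truncated
    subtraction \<open>t - 1\<close> and matches the induction step in
    \<open>telescope\<close>.\<close>
  have step: "w \<alpha> (Suc t) = w \<alpha> t + d (Suc t) - f (Suc t)" for t
    using assms(10) \<alpha> unfolding herding_dynamics_def f_def d_def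
    by (metis diff_Suc_1 le_add1 plus_1_eq_Suc)
  have telescope: "(\<Sum>t=1..T. f t) - (\<Sum>t=1..T. d t) = w \<alpha> 0 - w \<alpha> T" for T
    by (induction T) (simp_all add: step)
  have "(\<lambda>T. (1 / real T) * (\<Sum>t=1..T. f t) - (1 / real T) * (\<Sum>t=1..T. d t))
      = (\<lambda>T. w \<alpha> 0 * (1 / real T) - (1 / real T) * w \<alpha> T)"
    \<comment> \<open>Factoring out \<open>1 / real T\<close> exposes the difference of sums that
      \<open>telescope\<close> rewrites. Since this factor is never cancelled, the identity also
      covers T = 0, where it is 0.\<close>
    by (simp only: right_diff_distrib [symmetric] telescope) (simp add: algebra_simps)
  \<comment> \<open>The limit stays in the unevaluated form \<open>w \<alpha> 0 * 0 - 0\<close> so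
    that the limit rules for differences and products match it.\<close>
  moreover have "(\<lambda>T. w \<alpha> 0 * (1 / real T) - (1 / real T) * w \<alpha> T) \<longlonglongrightarrow> w \<alpha> 0 * 0 - 0"
    by (intro tendsto_intros lim_1_over_n assms(11) \<alpha>)
  ultimately show "(\<lambda>T. (1 / real T) * (\<Sum>t=1..T. feature_value XS ZS g \<alpha> (s t))
                   - (1 / real T) * (\<Sum>t=1..T. data_average XS ZS g N x zstar \<alpha> t))
                \<longlonglongrightarrow> 0"
    by (simp add: f_def d_def)
qed

end
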